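(* Let $m\ge 1$, let $\mathcal{C}$ be a (random) corpus and $\bar q=q_1\cdots q_m$ a (random) query of length $m$, and let $R_i,R'_i,\mathit{Total}$ be as defined in the context. Assume: (i) there is a constant $A$, independent of $\mathcal{C}$, such that $\mathbf{E}[|R'_i|]\le A\,\mathbf{E}[|R_{i-1}|]$ for every $1\le i\le m$; (ii) there are constants $a>0$ and $r>0$, independent of $i$, such that $\mathbf{E}[|R_i|]\le a\,r^i$ for every $i$ with $0\le i\le m$. If $r\neq 1$, then the expected number of exact lookups performed by the search algorithm satisfies $$\mathbf{E}[\mathit{Total}]\le A\,a\,\frac{1-r^m}{1-r}.$$
   Context: $\mathcal{V}$ is a countable set of tokens (the vocabulary) and $\mathcal{V}^*$ is the set of finite token sequences (patterns), including the empty sequence; $\cdot$ denotes concatenation. A corpus $\mathcal{C}$ is a finite token sequence. A pattern $w$ occurs in $\mathcal{C}$ if it is a contiguous subsequence of $\mathcal{C}$ (the empty pattern always occurs). $\mathrm{sim}:\mathcal{V}^*\times\mathcal{V}^*\to[0,\infty)$ is a given similarity function between a query (prefix) and a pattern, and $\alpha>0$ is a threshold; both are fixed. Corpus and query are random variables, and $\mathbf{E}$ denotes expectation over them. Search algorithm: for a query $\bar q=q_1\cdots q_m\in\mathcal{V}^m$, set $R_0=\{\text{empty sequence}\}$, and for $i=1,\dots,m$, $$R'_i=\{w\cdot w' \mid w\in R_{i-1},\ w'\in\mathcal{V}^*,\ \mathrm{sim}(q_1\cdots q_i,\,w\cdot w')\ge\alpha\},\qquad R_i=\{w\in R'_i\mid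 w\text{ occurs in }\mathcal{C}\};$$ the output is $R_m$. Each element of each $R'_i$ requires one exact lookup in the corpus, so the total number of exact lookups is $\mathit{Total}=\sum_{i=1}^m|R'_i|$. *)

theory Defs
  imports "HOL-Probability.Probability" "HOL-Library.Sublist"
begin

definition extensions ::
  "('a list \<Rightarrow> 'a list \<Rightarrow> real) \<Rightarrow> real \<Rightarrow> 'a list \<Rightarrow> 'a list set \<Rightarrow> 'a list set" where
  "extensions sim \<alpha> p R = {w @ w' | w w'. w \<in> R \<and> sim p (w @ w') \<ge> \<alpha>}"

text \<open>Occurrence of a pattern in the corpus is \<^const>\<open>sublist\<close>, which is the contiguous
  sublist relation (not \<^const>\<open>subseq\<close>). \<open>take i q\<close> is the prefix of the first \<open>i\<close> tokens.\<close>

primrec retained ::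
  "('a list \<Rightarrow> 'a list \<Rightarrow> real) \<Rightarrow> real \<Rightarrow> 'a list \<Rightarrow> 'a list \<Rightarrow> nat \<Rightarrow> 'a list set" where
  "retained sim \<alpha> C q 0 = {[]}"
| "retained sim \<alpha> C q (Suc i) =
     {w \<in> extensions sim \<alpha> (take (Suc i) q) (retained sim \<alpha> C q i). sublist w C}"

text \<open>The sets \<open>R'\<^sub>i\<close>; only meaningful for \<open>1 \<le> i \<le> length q\<close>.\<close>

definition candidates ::
  "('a list \<Rightarrow> 'a list \<Rightarrow> real) \<Rightarrow> real \<Rightarrow> 'a list \<Rightarrow> 'a list \<Rightarrow> nat \<Rightarrow> 'a list set" where
  "candidates sim \<alpha> C q i = extensions sim \<alpha> (take i q) (retained sim \<alpha> C q (i - 1))"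

text \<open>A candidate set may be infinite, so cardinalities are \<open>\<infinity>\<close>-valued; \<^const>\<open>card\<close> would
  silently give \<open>0\<close> there.\<close>

abbreviation ecard :: "'a set \<Rightarrow> ennreal" where
  "ecard S \<equiv> emeasure (count_space UNIV) S"

definition total_lookups ::
  "('a list \<Rightarrow> 'a list \<Rightarrow> real) \<Rightarrow> real \<Rightarrow> 'a list \<Rightarrow> 'a list \<Rightarrow> ennreal" where
  "total_lookups sim \<alpha> C q = (\<Sum>i = 1..length q. ecard (candidates sim \<alpha> C q i))"

text \<open>Expectation of a \<open>[0,\<infinity>]\<close>-valued random variable, viewed in \<^typ>\<open>ereal\<close> so that it can
  be compared with products involving real constants of any sign (the coercion
  \<^const>\<open>ennreal\<close> would clip negative constants to \<open>0\<close>).\<close>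

definition eexpectation :: "'b measure \<Rightarrow> ('b \<Rightarrow> ennreal) \<Rightarrow> ereal" where
  "eexpectation M X = enn2ereal (\<integral>\<^sup>+ \<omega>. X \<omega> \<partial>M)"

end

theory Submission imports Defs begin

text \<open>By linearity of expectation, the expected total is the sum of the expected sizes of the
  candidate sets. Assumptions (i) and (ii) bound the \<open>i\<close>-th term by
  \<open>A * a * r ^ (i - 1)\<close>, and these bounds form a geometric series. Two points need
  care: linearity requires measurable summands (\<open>measurable_countable_pair\<close>), and
  chaining (i) with (ii) requires \<open>A \<ge> 0\<close>, which is derived from (i) at
  \<open>i = 1\<close>.\<close>

lemma measurable_countable_pair:
  fixes C :: "'b \<Rightarrow> 'c::countable" and f :: "'c \<Rightarrow> 'd \<Rightarrow> ennreal"
  assumes "C \<in> M \<rightarrow>\<^sub>M count_space UNIV" and "Q \<in> M \<rightarrow>\<^sub>M count_space B"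
  shows "(\<lambda>\<omega>. f (C \<omega>) (Q \<omega>)) \<in> borel_measurable M"
\<comment> \<open>Since \<open>C\<close> has only countably many values, it can be frozen at each of
  them; what remains is a function of \<open>Q\<close> alone, and every function on a
  \<open>count_space\<close> is measurable.\<close>
proof (rule measurable_compose_countable[OF _ assms(1)])
  show "(\<lambda>\<omega>. f c (Q \<omega>)) \<in> borel_measurable M" for c
    by (rule measurable_compose[OF assms(2)]) simp
qed

lemma eexpectation_nonneg: "0 \<le> eexpectation M X"
  by (simp add: eexpectation_def)

lemma eexpectation_sum:
  assumes "\<And>i. i \<in> I \<Longrightarrow> X i \<in> borel_measurable M"
  shows "eexpectation M (\<lambda>\<omega>. \<Sum>i\<in>I. X i \<omega>) = (\<Sum>i\<in>I. eexpectation M (X i))"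
  using assms by (simp add: eexpectation_def nn_integral_sum)

text \<open>The initial set is a singleton for every corpus and query, so the integral is the total
  mass of \<open>M\<close>. This value turns (i) at \<open>i = 1\<close> into a bound by
  \<open>A\<close> itself.\<close>

lemma eexpectation_ecard_retained_0:
  assumes "prob_space M"
  shows "eexpectation M (\<lambda>\<omega>. ecard (retained sim \<alpha> (C \<omega>) (Q \<omega>) 0)) = 1"
  using prob_space.emeasure_space_1[OF assms] by (simp add: eexpectation_def one_ennreal.rep_eq)

theorem theorem2:
  fixes M :: "'b measure"
    and sim :: "'a::countable list \<Rightarrow> 'a list \<Rightarrow> real"
    and \<alpha> A a r :: real
    and m :: nat
    and C Q :: "'b \<Rightarrow> 'a list"
  assumes "prob_space M"
    and "\<And>p w. sim p w \<ge> 0"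
    and "\<alpha> > 0"
    and "m \<ge> 1"
    and "C \<in> M \<rightarrow>\<^sub>M count_space UNIV"
    and "Q \<in> M \<rightarrow>\<^sub>M count_space {q. length q = m}"
    and "\<And>i. 1 \<le> i \<Longrightarrow> i \<le> m \<Longrightarrow>
           eexpectation M (\<lambda>\<omega>. ecard (candidates sim \<alpha> (C \<omega>) (Q \<omega>) i))
             \<le> ereal A * eexpectation M (\<lambda>\<omega>. ecard (retained sim \<alpha> (C \<omega>) (Q \<omega>) (i - 1)))"
    and "a > 0" and "r > 0"
    and "\<And>i. i \<le> m \<Longrightarrow>
           eexpectation M (\<lambda>\<omega>. ecard (retained sim \<alpha> (C \<omega>) (Q \<omega>) i)) \<le> ereal (a * r ^ i)"
    and "r \<noteq> 1"
  shows "eexpectation M (\<lambda>\<omega>. total_lookups sim \<alpha> (C \<omega>) (Q \<omega>))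
           \<le> ereal (A * a * ((1 - r ^ m) / (1 - r)))"
proof -
  let ?cand = "\<lambda>i. eexpectation M (\<lambda>\<omega>. ecard (candidates sim \<alpha> (C \<omega>) (Q \<omega>) i))"
  \<comment> \<open>The sign of \<open>A\<close> is read off from
    \<open>0 \<le> ?cand 1 \<le> A * 1\<close>.\<close>
  have "0 \<le> ?cand 1" by (rule eexpectation_nonneg)
  also have "\<dots> \<le> ereal A"
    using assms(7)[of 1] \<open>m \<ge> 1\<close> eexpectation_ecard_retained_0[OF \<open>prob_space M\<close>, of sim \<alpha> C Q]
    by simp
  finally have "A \<ge> 0" by simp
  have cand: "?cand i \<le> ereal (A * a * r ^ (i - 1))" if "i \<in> {1..m}" for i
  proof -
    \<comment> \<open>Multiplying (ii) at \<open>i - 1\<close> by \<open>A\<close> preserves the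
      inequality because \<open>A \<ge> 0\<close>.\<close>
    have "?cand i \<le> ereal A * ereal (a * r ^ (i - 1))"
      using that assms(7)[of i] assms(10)[of "i - 1"] \<open>A \<ge> 0\<close>
      by (intro order_trans[OF assms(7) ereal_mult_left_mono]) auto
    then show ?thesis by (simp add: mult.assoc)
  qed
  have len: "length (Q \<omega>) = m" if "\<omega> \<in> space M" for \<omega>
    using measurable_space[OF assms(6) that] by simp
  \<comment> \<open>The upper limit \<open>length (Q \<omega>)\<close> is random in form, but equals
    \<open>m\<close> on \<open>space M\<close>, the only points the integral sees. With a fixed
    index set, linearity applies.\<close>
  have "eexpectation M (\<lambda>\<omega>. total_lookups sim \<alpha> (C \<omega>) (Q \<omega>))
      = eexpectation M (\<lambda>\<omega>. \<Sum>i = 1..m. ecard (candidates sim \<alpha> (C \<omega>) (Q \<omega>) i))"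
    unfolding eexpectation_def total_lookups_def
    by (intro arg_cong[where f = enn2ereal] nn_integral_cong) (simp only: len)
  also have "\<dots> = (\<Sum>i = 1..m. ?cand i)"
    by (intro eexpectation_sum measurable_countable_pair[OF assms(5,6)])
  also have "\<dots> \<le> (\<Sum>i = 1..m. ereal (A * a * r ^ (i - 1)))"
    by (intro sum_mono cand)
  also have "\<dots> = ereal (A * a * (\<Sum>i<m. r ^ i))"
    by (simp add: sum.atLeast1_atMost_eq sum_distrib_left)
  also have "(\<Sum>i<m. r ^ i) = (1 - r ^ m) / (1 - r)"
    using \<open>r \<noteq> 1\<close> by (simp add: sum_gp_strict)
  finally show ?thesis .
qed

end
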